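(* Let $S\subseteq\mathbb N^2$ be a symmetric (local) good semigroup with minimal nonzero element $\boldsymbol e=(e_1,e_2)$, and let $\mathrm{Ap}(S)=\bigcup_{i=1}^e A_i$ be the partition of its Apéry set into levels. Assume $e_1\ge e_2$. (1) If $e$ is even, there exists a sequence of elements $\alpha^{(1)},\alpha^{(2)},\dots,\alpha^{(e)}$ such that $\alpha^{(i)}\in A_i$ and $\alpha^{(i)}+\alpha^{(e-i+1)}=\alpha^{(e)}$ for every $i=1,\dots,e$. (2) If $e$ is odd, set $e=2d-1$. Then there exists a sequence of elements $\alpha^{(1)},\alpha^{(2)},\dots,\alpha^{(e)},\beta$ such that $\alpha^{(i)}\in A_i$ for every $i$, $\beta\in A_d$, $\alpha^{(i)}+\alpha^{(e-i+1)}=\alpha^{(e)}$ for every $i\ne d$, and moreover $\alpha^{(d)}+\beta=\alpha^{(e)}$.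
   Context: $\mathbb N$ is the set of nonnegative integers. On $\mathbb Z^2$, $\alpha\le\beta$ is the componentwise order; $\alpha\wedge\beta$ is the componentwise minimum; $\alpha\ll\beta$ means $\alpha_1<\beta_1$ and $\alpha_2<\beta_2$; $\alpha\le\le\beta$ means $\alpha=\beta$ or $\alpha\ll\beta$. A good semigroup is a submonoid $S$ of $(\mathbb N^2,+)$ such that: (G1) $\alpha,\beta\in S\Rightarrow\alpha\wedge\beta\in S$; (G2) if $\alpha,\beta\in S$ and $\alpha_i=\beta_i$ for some $i\in\{1,2\}$, where $j$ is the other index, then there is $\delta\in S$ with $\delta_i>\alpha_i=\beta_i$, $\delta_j\ge\min\{\alpha_j,\beta_j\}$, and $\delta_j=\min\{\alpha_j,\beta_j\}$ if $\alpha_j\neq\beta_j$; (G3) there is $c\in S$ with $c+\mathbb N^2\subseteq S$. All good semigroups are assumed local: $(0,0)$ is the only element with a zero component. $\boldsymbol e=(e_1,e_2)$ is the minimum of $S\setminus\{(0,0)\}$, and $\mathrm{Ap}(S)=\{\alpha\in S:\alpha-\boldsymbol e\notin S\}$. The conductor is $\boldsymbol c=\min\{\alpha\in\mathbb Z^2:\alpha+\mathbb N^2\subseteq S\}$ and $\boldsymbol\gamma=\boldsymbol c-(1,1)$. For $\alpha\in\mathbb Z^2$, $\Delta^S(\alpha)$ is the set of $\beta\in S$ such that ($\beta_1=\alpha_1$ and $\beta_2>\alpha_2$) or ($\beta_2=\alpha_2$ and $\beta_1>\alpha_1$). $S$ is symmetric if for every $\alpha\in\mathbb N^2$: $\alpha\in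 S\iff\Delta^S(\boldsymbol\gamma-\alpha)=\emptyset$. Levels: for $i\ge1$, having defined $D^{(1)},\dots,D^{(i-1)}$, let $B^{(i)}$ be the set of elements of $\mathrm{Ap}(S)\setminus\bigcup_{j<i}D^{(j)}$ maximal in it with respect to $\le\le$, let $C^{(i)}=\{\alpha\in B^{(i)}:\alpha=\beta_1\wedge\beta_2\text{ for some }\beta_1,\beta_2\in B^{(i)}\setminus\{\alpha\}\}$, and $D^{(i)}=B^{(i)}\setminus C^{(i)}$. For some least $N$, $\mathrm{Ap}(S)$ is the disjoint union of $D^{(1)},\dots,D^{(N)}$, and $A_i=D^{(N+1-i)}$. It is a fact that $N=e_1+e_2$; this number is denoted $e$. *)

theory Defs
  imports Main "HOL-Library.Product_Order" "HOL-Library.Product_Plus"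
begin

text \<open>
  Elements of \<open>\<int>\<^sup>2\<close> are pairs of type \<^typ>\<open>int \<times> int\<close>, with the componentwise order,
  minimum \<^const>\<open>inf\<close> and addition from the library; \<open>\<nat>\<^sup>2\<close> is \<open>{0..}\<close>.
\<close>

definition strictly_below :: "int \<times> int \<Rightarrow> int \<times> int \<Rightarrow> bool"  (infix "\<lless>" 50) where
  "\<alpha> \<lless> \<beta> \<longleftrightarrow> fst \<alpha> < fst \<beta> \<and> snd \<alpha> < snd \<beta>"

definition lele :: "int \<times> int \<Rightarrow> int \<times> int \<Rightarrow> bool"  (infix "\<le>\<le>" 50) where
  "\<alpha> \<le>\<le> \<beta> \<longleftrightarrow> \<alpha> = \<beta> \<or> \<alpha> \<lless> \<beta>"

text \<open>
  The conjuncts after closure under addition are (G1), (G2) for \<open>i = 1\<close> and for \<open>i = 2\<close>,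
  and (G3).
\<close>

definition good_semigroup :: "(int \<times> int) set \<Rightarrow> bool" where
  "good_semigroup S \<longleftrightarrow>
     S \<subseteq> {0..} \<and> 0 \<in> S \<and> (\<forall>\<alpha>\<in>S. \<forall>\<beta>\<in>S. \<alpha> + \<beta> \<in> S) \<and>
     (\<forall>\<alpha>\<in>S. \<forall>\<beta>\<in>S. inf \<alpha> \<beta> \<in> S) \<and>
     (\<forall>\<alpha>\<in>S. \<forall>\<beta>\<in>S. fst \<alpha> = fst \<beta> \<longrightarrow>
        (\<exists>\<delta>\<in>S. fst \<delta> > fst \<alpha> \<and> snd \<delta> \<ge> min (snd \<alpha>) (snd \<beta>) \<and>
           (snd \<alpha> \<noteq> snd \<beta> \<longrightarrow> snd \<delta> = min (snd \<alpha>) (snd \<beta>)))) \<and>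
     (\<forall>\<alpha>\<in>S. \<forall>\<beta>\<in>S. snd \<alpha> = snd \<beta> \<longrightarrow>
        (\<exists>\<delta>\<in>S. snd \<delta> > snd \<alpha> \<and> fst \<delta> \<ge> min (fst \<alpha>) (fst \<beta>) \<and>
           (fst \<alpha> \<noteq> fst \<beta> \<longrightarrow> fst \<delta> = min (fst \<alpha>) (fst \<beta>)))) \<and>
     (\<exists>c\<in>S. \<forall>\<nu>\<ge>0. c + \<nu> \<in> S)"

definition local_good_semigroup :: "(int \<times> int) set \<Rightarrow> bool" where
  "local_good_semigroup S \<longleftrightarrow>
     good_semigroup S \<and> (\<forall>\<alpha>\<in>S. fst \<alpha> = 0 \<or> snd \<alpha> = 0 \<longrightarrow> \<alpha> = 0)"

text \<open>
  Both minima below are with respect to the componentwise partial order; for a local good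
  semigroup they exist because of (G1) and (G3).
\<close>

definition min_nonzero :: "(int \<times> int) set \<Rightarrow> int \<times> int" where
  "min_nonzero S = (LEAST \<alpha>. \<alpha> \<in> S - {0})"

definition conductor :: "(int \<times> int) set \<Rightarrow> int \<times> int" where
  "conductor S = (LEAST \<alpha>. \<forall>\<nu>\<ge>0. \<alpha> + \<nu> \<in> S)"

definition gamma :: "(int \<times> int) set \<Rightarrow> int \<times> int" where
  "gamma S = conductor S - (1, 1)"

definition Delta :: "(int \<times> int) set \<Rightarrow> int \<times> int \<Rightarrow> (int \<times> int) set" where
  "Delta S \<alpha> = {\<beta> \<in> S. (fst \<beta> = fst \<alpha> \<and> snd \<beta> > snd \<alpha>) \<or> (snd \<beta> = snd \<alpha> \<and> fst \<beta> > fst \<alpha>)}"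

definition symmetric_semigroup :: "(int \<times> int) set \<Rightarrow> bool" where
  "symmetric_semigroup S \<longleftrightarrow> (\<forall>\<alpha>\<ge>0. \<alpha> \<in> S \<longleftrightarrow> Delta S (gamma S - \<alpha>) = {})"

definition Apery :: "(int \<times> int) set \<Rightarrow> (int \<times> int) set" where
  "Apery S = {\<alpha> \<in> S. \<alpha> - min_nonzero S \<notin> S}"

definition lele_maximal :: "(int \<times> int) set \<Rightarrow> (int \<times> int) set" where
  "lele_maximal X = {\<alpha> \<in> X. \<forall>\<beta>\<in>X. \<alpha> \<le>\<le> \<beta> \<longrightarrow> \<beta> = \<alpha>}"

definition proper_infima :: "(int \<times> int) set \<Rightarrow> (int \<times> int) set" where
  "proper_infima B = {\<alpha> \<in> B. \<exists>\<beta>\<^sub>1 \<in> B - {\<alpha>}. \<exists>\<beta>\<^sub>2 \<in> B - {\<alpha>}. \<alpha> = inf \<beta>\<^sub>1 \<beta>\<^sub>2}"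

text \<open>
  \<open>level_D S i\<close> is \<open>D\<^sup>(\<^sup>i\<^sup>)\<close>, with \<open>B\<^sup>(\<^sup>i\<^sup>) = lele_maximal \<dots>\<close> and \<open>C\<^sup>(\<^sup>i\<^sup>) = proper_infima B\<^sup>(\<^sup>i\<^sup>)\<close>.
  Indices start at \<open>1\<close>; the value at \<open>0\<close> is junk and is never used.
\<close>

fun level_D :: "(int \<times> int) set \<Rightarrow> nat \<Rightarrow> (int \<times> int) set" where
  "level_D S i =
     (let B = lele_maximal (Apery S - (\<Union>j\<in>{1..<i}. level_D S j)) in B - proper_infima B)"

declare level_D.simps [simp del]

definition num_levels :: "(int \<times> int) set \<Rightarrow> nat" where
  "num_levels S = (LEAST N. Apery S = (\<Union>i\<in>{1..N}. level_D S i))"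

text \<open>The levels in increasing order, meaningful for \<open>1 \<le> i \<le> num_levels S\<close>.\<close>

definition level_A :: "(int \<times> int) set \<Rightarrow> nat \<Rightarrow> (int \<times> int) set" where
  "level_A S i = level_D S (num_levels S + 1 - i)"

end

theory Submission
  imports Defs
begin

text \<open>
  For a lattice point \<open>p\<close>, count the unit steps of a monotone lattice path from \<open>0\<close> to \<open>p\<close> whose
  ray of points above (for a step to the right) or to the right (for a step upwards) meets \<open>S\<close>;
  by (G2) the count does not depend on the path. Subtracting the same count for the ideal
  \<open>\<^bold>e + S\<close> gives a function \<open>height\<close> which grows by \<open>0\<close> or \<open>1\<close> along each unit step, from \<open>0\<close> to
  \<open>e = e\<^sub>1 + e\<^sub>2\<close>. The level \<open>A\<^sub>i\<close> consists of the elements of the Apery set of height \<open>i - 1\<close>; in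
  particular there are \<open>e\<close> levels.

  If \<open>S\<close> is symmetric, then \<open>height (\<^bold>c + \<^bold>e - p) = e - height p\<close>. Along the first axis the height
  takes \<open>e\<^sub>1\<close> jumps; if \<open>a\<close> is the abscissa of the \<open>i\<close>-th one, the lowest element \<open>(a, b)\<close> of \<open>S\<close> in
  the column of \<open>a\<close> lies in \<open>A\<^sub>i\<close>, and by the duality \<open>\<omega> - (a, b)\<close> lies in \<open>A\<^bsub>e+1-i\<^esub>\<close>, where \<open>\<omega>\<close> is a fixed element high up in the column \<open>\<gamma>\<^sub>1 + e\<^sub>1\<close>. As \<open>e\<^sub>1 \<ge> e\<^sub>2\<close>, this covers all
  \<open>i \<le> (e + 1) / 2\<close>.
\<close>

section \<open>Integer sums and existence of least elements\<close>

lemma sum_atLeastLessThan_int_Suc: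
  fixes g :: "int \<Rightarrow> int"
  shows "0 \<le> x \<Longrightarrow> (\<Sum>i\<in>{0..<x + 1}. g i) = (\<Sum>i\<in>{0..<x}. g i) + g x"
proof -
  assume "0 \<le> x"
  then have "{0..<x + 1} = insert x {0..<x}" by auto
  then show ?thesis by (simp add: add.commute)
qed

lemma least_int_above:
  fixes m :: int
  assumes "P t" "m \<le> t"
  obtains s where "m \<le> s" "P s" "\<And>r. m \<le> r \<Longrightarrow> r < s \<Longrightarrow> \<not> P r"
proof -
  define k where "k = (LEAST k. P (m + int k))"
  have "P (m + int (nat (t - m)))" using assms by simp
  then have "P (m + int k)" unfolding k_def by (rule LeastI)
  moreover have "\<not> P r" if "m \<le> r" "r < m + int k" for r
    using not_less_Least[of "nat (r - m)" "\<lambda>k. P (m + int k)"] that by (auto simp: k_def[symmetric])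
  ultimately show ?thesis using that[of "m + int k"] by auto
qed

text \<open>The order is only partial, so existence is at stake: the infimum of an element with
  least first coordinate and one with least second coordinate lies below everything.\<close>

lemma Least_of_inf_closed:
  fixes X :: "(int \<times> int) set"
  assumes "X \<noteq> {}" "X \<subseteq> {0..}" and inf: "\<And>p q. p \<in> X \<Longrightarrow> q \<in> X \<Longrightarrow> inf p q \<in> X"
  shows "(LEAST p. p \<in> X) \<in> X"
proof -
  obtain r where r: "r \<in> X" using assms(1) by blast
  obtain p where p: "p \<in> X" "\<And>q. q \<in> X \<Longrightarrow> nat (fst p) \<le> nat (fst q)"
    using ex_has_least_nat[of "\<lambda>p. p \<in> X" r "\<lambda>p. nat (fst p)"] r by blast
  obtain q where q: "q \<in> X" "\<And>r. r \<in> X \<Longrightarrow> nat (snd q) \<le> nat (snd r)"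
    using ex_has_least_nat[of "\<lambda>p. p \<in> X" r "\<lambda>p. nat (snd p)"] r by blast
  have nonneg: "0 \<le> fst r \<and> 0 \<le> snd r" if "r \<in> X" for r
    using assms(2) that by (auto simp: less_eq_prod_def)
  have "inf p q \<le> r" if "r \<in> X" for r
    using p(2)[OF that] q(2)[OF that] nonneg[OF that] by (auto simp: less_eq_prod_def inf_int_def)
  then have "(LEAST p. p \<in> X) = inf p q"
    using inf[OF p(1) q(1)] by (intro Least_equality)
  then show ?thesis using inf[OF p(1) q(1)] by simp
qed

section \<open>Good semigroups in coordinates; the \<open>exchange\<close> axioms are (G2) for
  distinct other coordinates\<close>

locale good_pair =
  fixes S :: "(int \<times> int) set" and e1 e2 c1 c2 :: int
  assumes nonneg: "(x, y) \<in> S \<Longrightarrow> 0 \<le> x \<and> 0 \<le> y"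
    and zero: "(0, 0) \<in> S"
    and add: "(x, y) \<in> S \<Longrightarrow> (x', y') \<in> S \<Longrightarrow> (x + x', y + y') \<in> S"
    and minimum: "(x, y) \<in> S \<Longrightarrow> (x', y') \<in> S \<Longrightarrow> (min x x', min y y') \<in> S"
    and exchange_right: "(x, y) \<in> S \<Longrightarrow> (x, y') \<in> S \<Longrightarrow> y < y' \<Longrightarrow> \<exists>x'>x. (x', y) \<in> S"
    and exchange_up: "(x, y) \<in> S \<Longrightarrow> (x', y) \<in> S \<Longrightarrow> x < x' \<Longrightarrow> \<exists>y'>y. (x, y') \<in> S"
    and local: "(x, y) \<in> S \<Longrightarrow> x = 0 \<or> y = 0 \<Longrightarrow> x = 0 \<and> y = 0"
    and above_c: "c1 \<le> x \<Longrightarrow> c2 \<le> y \<Longrightarrow> (x, y) \<in> S"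
    and e_mem: "(e1, e2) \<in> S"
    and e_pos: "0 < e1" "0 < e2"
begin

section \<open>Rays meeting \<open>S\<close> and step counts along lattice paths\<close>

definition col :: "int \<Rightarrow> int \<Rightarrow> bool" where
  "col x y \<longleftrightarrow> (\<exists>t\<ge>y. (x, t) \<in> S)"

definition row :: "int \<Rightarrow> int \<Rightarrow> bool" where
  "row x y \<longleftrightarrow> (\<exists>t\<ge>x. (t, y) \<in> S)"

text \<open>
  The step count for the lattice path which runs along the first axis to \<open>(x, 0)\<close> and then upwards to \<open>(x, y)\<close>.
\<close>

definition len :: "int \<Rightarrow> int \<Rightarrow> int" where
  "len x y = (\<Sum>i\<in>{0..<x}. of_bool (col i 0)) + (\<Sum>j\<in>{0..<y}. of_bool (row x j))"

definition height :: "int \<Rightarrow> int \<Rightarrow> int" where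
  "height x y = len x y - len (x - e1) (y - e2)"

definition Ap :: "(int \<times> int) set" where
  "Ap = {p \<in> S. p - (e1, e2) \<notin> S}"

lemma Ap_iff: "(x, y) \<in> Ap \<longleftrightarrow> (x, y) \<in> S \<and> (x - e1, y - e2) \<notin> S"
  by (simp add: Ap_def)

lemma c_nonneg: "0 \<le> c1" "0 \<le> c2"
  using nonneg[OF above_c[of c1 c2]] by auto

lemma col_nonpos: "y \<le> 0 \<Longrightarrow> col x y \<longleftrightarrow> col x 0"
  unfolding col_def using nonneg by (meson order_trans)

lemma col_neg: "x < 0 \<Longrightarrow> \<not> col x y"
  unfolding col_def using nonneg by force

lemma row_neg: "y < 0 \<Longrightarrow> \<not> row x y"
  unfolding row_def using nonneg by force

lemma colI: "(x, t) \<in> S \<Longrightarrow> y \<le> t \<Longrightarrow> col x y"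
  unfolding col_def by blast

lemma rowI: "(t, y) \<in> S \<Longrightarrow> x \<le> t \<Longrightarrow> row x y"
  unfolding row_def by blast

lemma colE: "col x y \<Longrightarrow> (\<And>t. y \<le> t \<Longrightarrow> (x, t) \<in> S \<Longrightarrow> thesis) \<Longrightarrow> thesis"
  unfolding col_def by blast

lemma rowE: "row x y \<Longrightarrow> (\<And>t. x \<le> t \<Longrightarrow> (t, y) \<in> S \<Longrightarrow> thesis) \<Longrightarrow> thesis"
  unfolding row_def by blast

lemma col_large: "c1 \<le> x \<Longrightarrow> col x y"
  by (rule colI[of x "max y c2"]) (auto intro: above_c)

lemma row_large: "c2 \<le> y \<Longrightarrow> row x y"
  by (rule rowI[of "max x c1" y]) (auto intro: above_c)

text \<open>By (G1): the point is the minimum of an element in its row and one in its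
  column.\<close>

lemma meet_mem: "row x y \<Longrightarrow> col x y \<Longrightarrow> (x, y) \<in> S"
  by (elim rowE colE) (metis minimum min.absorb1 min.absorb2)

lemma col_shift: "col (x - e1) (y - e2) \<Longrightarrow> col x y"
proof (elim colE)
  fix t assume "y - e2 \<le> t" "(x - e1, t) \<in> S"
  then show "col x y" using add[OF _ e_mem] by (intro colI[of x "t + e2"]) fastforce+
qed

lemma row_shift: "row (x - e1) (y - e2) \<Longrightarrow> row x y"
proof (elim rowE)
  fix t assume "x - e1 \<le> t" "(t, y - e2) \<in> S"
  then show "row x y" using add[OF _ e_mem] by (intro rowI[of "t + e1" y]) fastforce+
qed

lemma col_Suc: "col x y \<longleftrightarrow> (x, y) \<in> S \<or> col x (y + 1)"
proof
  assume "col x y"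
  then show "(x, y) \<in> S \<or> col x (y + 1)"
    by (elim colE) (metis colI order_le_less zless_imp_add1_zle)
qed (auto elim!: colE intro: colI)

lemma row_Suc: "row x y \<longleftrightarrow> (x, y) \<in> S \<or> row (x + 1) y"
proof
  assume "row x y"
  then show "(x, y) \<in> S \<or> row (x + 1) y"
    by (elim rowE) (metis rowI order_le_less zless_imp_add1_zle)
qed (auto elim!: rowE intro: rowI)

lemma mem_col_iff_row:
  assumes "(x, y) \<in> S"
  shows "col x (y + 1) \<longleftrightarrow> row (x + 1) y"
proof
  assume "col x (y + 1)"
  then obtain t where "y < t" "(x, t) \<in> S" by (elim colE) force
  then obtain x' where "x' > x" "(x', y) \<in> S" using exchange_right[OF assms] by blast
  then show "row (x + 1) y" by (auto intro: rowI)
next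
  assume "row (x + 1) y"
  then obtain t where "x < t" "(t, y) \<in> S" by (elim rowE) force
  then obtain y' where "y' > y" "(x, y') \<in> S" using exchange_up[OF assms] by blast
  then show "col x (y + 1)" by (auto intro: colI)
qed

text \<open>This is where (G2) enters: it makes the count \<open>len\<close> independent of the chosen lattice path.\<close>

lemma unit_square:
  "of_bool (col x y) + of_bool (row (x + 1) y) = (of_bool (row x y) + of_bool (col x (y + 1)) :: int)"
  using mem_col_iff_row[of x y] col_Suc[of x y] row_Suc[of x y]
  by (cases "(x, y) \<in> S") auto

lemma len_up: "len x (y + 1) = len x y + of_bool (row x y)"
  by (cases "0 \<le> y") (auto simp: len_def sum_atLeastLessThan_int_Suc row_neg simp del: sum_of_bool_eq)

lemma len_nonpos_y: "y \<le> 0 \<Longrightarrow> len x y = len x 0"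
  by (simp add: len_def)

text \<open>The path in \<open>len\<close> goes up last, so this is immediate only for
  \<open>y \<le> 0\<close>; \<open>unit_square\<close> carries it upwards.\<close>

lemma len_right: "len (x + 1) y = len x y + of_bool (col x y)"
proof -
  have base: "len (x + 1) y = len x y + of_bool (col x y)" if "y \<le> 0" for y
    using that col_nonpos[of y x]
    by (cases "0 \<le> x") (auto simp: len_def sum_atLeastLessThan_int_Suc col_neg simp del: sum_of_bool_eq)
  show ?thesis
  proof (cases "y \<le> 0")
    case False
    then have "0 \<le> y" by simp
    then show ?thesis
    proof (induction y rule: int_ge_induct)
      case (step y)
      then show ?case using unit_square[of x y] by (simp add: len_up)
    qed (simp add: base)
  qed (rule base)
qed

section \<open>Counts far out, and increments of the height\<close>

lemma len_add_right:
  assumes "c1 \<le> x" "0 \<le> n"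
  shows "len (x + n) y = len x y + n"
  using assms(2)
proof (induction n rule: int_ge_induct)
  case (step n)
  then show ?case using assms(1) len_right[of "x + n" y] by (simp add: col_large add.assoc)
qed simp

lemma len_add_up:
  assumes "c2 \<le> y" "0 \<le> n"
  shows "len x (y + n) = len x y + n"
  using assms(2)
proof (induction n rule: int_ge_induct)
  case (step n)
  then show ?case using assms(1) len_up[of x "y + n"] by (simp add: row_large add.assoc)
qed simp

text \<open>Translation by \<open>(e1, e2)\<close> maps \<open>S\<close> into itself, so a step
  counted for the translate is also counted for \<open>S\<close>; the difference is therefore again
  an indicator.\<close>

lemma height_right:
  "height (x + 1) y = height x y + of_bool (col x y \<and> \<not> col (x - e1) (y - e2))"
  using col_shift[of x y] len_right[of "x - e1" "y - e2"]
  by (simp add: height_def len_right diff_add_eq)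

lemma height_up:
  "height x (y + 1) = height x y + of_bool (row x y \<and> \<not> row (x - e1) (y - e2))"
  using row_shift[of x y] len_up[of "x - e1" "y - e2"]
  by (simp add: height_def len_up diff_add_eq)

lemma height_mono:
  assumes "x \<le> x'" "y \<le> y'"
  shows "height x y \<le> height x' y'"
proof -
  have "height x y \<le> height x' y"
    using assms(1) by (induction x' rule: int_ge_induct) (auto simp: height_right)
  also have "\<dots> \<le> height x' y'"
    using assms(2) by (induction y' rule: int_ge_induct) (auto simp: height_up)
  finally show ?thesis .
qed

text \<open>The two points compared are joined by \<open>e2\<close> steps up and \<open>e1\<close>
  steps right, all of them counted.\<close>

lemma height_large:
  assumes "c1 + e1 \<le> x" "c2 + e2 \<le> y"
  shows "height x y = e1 + e2"
  using assms e_pos len_add_right[of "x - e1" e1 y] len_add_up[of "y - e2" e2 "x - e1"]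
  by (simp add: height_def)

lemma height_nonpos_y: "y \<le> 0 \<Longrightarrow> height x y = height x 0"
  using e_pos len_nonpos_y[of y x] len_nonpos_y[of "y - e2" "x - e1"] len_nonpos_y[of "- e2" "x - e1"]
  by (simp add: height_def)

lemma height_large_x: "c1 + e1 \<le> x \<Longrightarrow> height x 0 = e1"
  using e_pos len_add_right[of "x - e1" e1 0] len_nonpos_y[of "- e2" "x - e1"]
  by (simp add: height_def)

lemma height_nonpos: "x \<le> 0 \<Longrightarrow> y \<le> 0 \<Longrightarrow> height x y = 0"
  using e_pos by (simp add: height_def len_def)

lemma height_le: "height x y \<le> e1 + e2"
  using height_mono[of x "max x (c1 + e1)" y "max y (c2 + e2)"] height_large by simp

section \<open>Heights of elements of the Apery set\<close>

lemma Ap_row_or_col: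
  assumes "(x, y) \<in> Ap"
  shows "\<not> col (x - e1) (y - e2) \<or> \<not> row (x - e1) (y - e2)"
  using assms meet_mem by (auto simp: Ap_iff)

lemma Ap_col_row: "(x, y) \<in> Ap \<Longrightarrow> col x y \<and> row x y"
  by (auto simp: Ap_iff intro: colI rowI)

text \<open>Both rays at \<open>(x, y)\<close> contain the point itself. Both translated rays cannot
  meet \<open>S\<close>, by \<open>meet_mem\<close>, so the step right or the step up is a
  jump.\<close>

lemma height_diagonal:
  assumes "(x, y) \<in> Ap"
  shows "height x y < height (x + 1) (y + 1)"
  using Ap_col_row[OF assms] Ap_row_or_col[OF assms]
    height_right[of x y] height_up[of x y] height_mono[of "x + 1" "x + 1" y "y + 1"]
    height_mono[of x "x + 1" "y + 1" "y + 1"]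
  by auto

lemma height_less: "(x, y) \<in> Ap \<Longrightarrow> height x y < e1 + e2"
  using height_diagonal height_le order_less_le_trans by blast

lemma height_strict_mono:
  "(x, y) \<in> Ap \<Longrightarrow> x < x' \<Longrightarrow> y < y' \<Longrightarrow> height x y < height x' y'"
  using height_diagonal[of x y] height_mono[of "x + 1" x' "y + 1" y'] by simp

text \<open>One of the two unit steps out of \<open>(x, y)\<close> is a jump. This keeps an element
  of top height from being a proper infimum.\<close>

lemma height_infimum:
  assumes "(x, y) \<in> Ap" "x < x'" "y < y'"
  shows "height x y < max (height x' y) (height x y')"
  using Ap_col_row[OF assms(1)] Ap_row_or_col[OF assms(1)]
    height_right[of x y] height_up[of x y]
    height_mono[of "x + 1" x' y y] height_mono[of x x "y + 1" y'] assms(2,3)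
  by auto

text \<open>Walk right or up as long as the height stays constant. Where the walk stops, both rays
  meet \<open>S\<close> and some step is a jump, which makes the point an Apery element.\<close>

lemma Ap_same_height:
  assumes "height x y < e1 + e2"
  shows "\<exists>x'\<ge>x. \<exists>y'\<ge>y. (x', y') \<in> Ap \<and> height x' y' = height x y"
proof -
  \<comment> \<open>The walk stays in the box with far corner \<open>(m, n)\<close>. The corner has
    height \<open>e1 + e2\<close>, so the walk cannot end there.\<close>
  define m where "m = max x (c1 + e1)"
  define n where "n = max y (c2 + e2)"
  have "x \<le> m" "y \<le> n" by (auto simp: m_def n_def)
  then show ?thesis using assms
  proof (induction "nat (m - x + (n - y))" arbitrary: x y rule: less_induct)
    case less
    show ?case
    proof (cases "x < m \<and> height (x + 1) y = height x y")
      case True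
      then have "\<exists>x'\<ge>x + 1. \<exists>y'\<ge>y. (x', y') \<in> Ap \<and> height x' y' = height (x + 1) y"
        using less.prems by (intro less.hyps) auto
      then obtain x' y' where "x + 1 \<le> x'" "y \<le> y'" "(x', y') \<in> Ap" "height x' y' = height x y"
        using True by auto
      then show ?thesis by (intro exI[of _ x'] conjI exI[of _ y']) auto
    next
      case False
      note nocol = this
      show ?thesis
      proof (cases "y < n \<and> height x (y + 1) = height x y")
        case True
        then have "\<exists>x'\<ge>x. \<exists>y'\<ge>y + 1. (x', y') \<in> Ap \<and> height x' y' = height x (y + 1)"
          using less.prems by (intro less.hyps) auto
        then obtain x' y' where "x \<le> x'" "y + 1 \<le> y'" "(x', y') \<in> Ap" "height x' y' = height x y"
          using True by auto
        then show ?thesis by (intro exI[of _ x'] conjI exI[of _ y']) auto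
      next
        case False
        have "x < m \<or> y < n"
          using less.prems height_large[of x y] by (force simp: m_def n_def)
        moreover have C: "col x y \<and> \<not> col (x - e1) (y - e2)" if "x < m"
          using nocol that height_right[of x y] by (auto split: if_splits)
        moreover have R: "row x y \<and> \<not> row (x - e1) (y - e2)" if "y < n"
          using False that height_up[of x y] by (auto split: if_splits)
        \<comment> \<open>On an edge of the box the ray is met because it runs beyond
          \<open>c1\<close> or \<open>c2\<close>.\<close>
        moreover have "col x y" if "\<not> x < m"
          using that less.prems e_pos by (intro col_large) (simp add: m_def)
        moreover have "row x y" if "\<not> y < n"
          using that less.prems e_pos by (intro row_large) (simp add: n_def)
        ultimately have "(x, y) \<in> S" "\<not> col (x - e1) (y - e2) \<or> \<not> row (x - e1) (y - e2)"
          using meet_mem by blast+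
        then have "(x, y) \<in> Ap" by (auto simp: Ap_iff dest: colI rowI)
        then show ?thesis by blast
      qed
    qed
  qed
qed

text \<open>The column ray at each \<open>(x, t)\<close> reaches \<open>(x, y')\<close>; if the row
  ray met \<open>S\<close> too, \<open>meet_mem\<close> would give \<open>(x, t) \<in> S\<close>. So
  no step up is counted.\<close>

lemma height_above_least_in_column:
  assumes "\<And>t. y \<le> t \<Longrightarrow> t < y' \<Longrightarrow> (x, t) \<notin> S" "(x, y') \<in> S" "y \<le> y'"
  shows "height x y' = height x y"
proof -
  have norow: "\<not> row x t" if "y \<le> t" "t < y'" for t
    using that assms(1)[of t] meet_mem[of x t] colI[OF assms(2), of t] by auto
  have "t \<le> y' \<Longrightarrow> height x t = height x y" if "y \<le> t" for t
    using that by (induction t rule: int_ge_induct) (auto simp: height_up norow)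
  from this[OF assms(3) order_refl] show ?thesis .
qed

lemma height_right_of_least_in_row:
  assumes "\<And>t. x \<le> t \<Longrightarrow> t < x' \<Longrightarrow> (t, y) \<notin> S" "(x', y) \<in> S" "x \<le> x'"
  shows "height x' y = height x y"
proof -
  have nocol: "\<not> col t y" if "x \<le> t" "t < x'" for t
    using that assms(1)[of t] meet_mem[of t y] rowI[OF assms(2), of t] by auto
  have "t \<le> x' \<Longrightarrow> height t y = height x y" if "x \<le> t" for t
    using that by (induction t rule: int_ge_induct) (auto simp: height_right nocol)
  from this[OF assms(3) order_refl] show ?thesis .
qed

text \<open>
  If the height jumps by \<open>2\<close> on the diagonal step, then \<open>(x, y)\<close> is the infimum of its two
  nearest neighbours in its column and row, otherwise there is an element strictly above it.
\<close>

lemma Ap_successor: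
  assumes p: "(x, y) \<in> Ap" and less: "height x y + 1 < e1 + e2"
  shows "(\<exists>x'>x. \<exists>y'>y. (x', y') \<in> Ap \<and> height x' y' = height x y + 1) \<or>
    (\<exists>x'>x. \<exists>y'>y. (x', y) \<in> Ap \<and> (x, y') \<in> Ap \<and>
      height x' y = height x y + 1 \<and> height x y' = height x y + 1)"
proof (cases "height (x + 1) (y + 1) = height x y + 1")
  case True
  then show ?thesis using Ap_same_height[of "x + 1" "y + 1"] less by force
next
  case False
  then have two: "height (x + 1) (y + 1) = height x y + 2"
    using height_diagonal[OF p] height_right[of x y] height_up[of "x + 1" y] by auto
  \<comment> \<open>A rise by 2 makes every edge of the unit square a jump, along either path round
    it.\<close>
  then have "of_bool (col x y \<and> \<not> col (x - e1) (y - e2))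
      + of_bool (row (x + 1) y \<and> \<not> row (x + 1 - e1) (y - e2)) = (2::int)"
    "of_bool (row x y \<and> \<not> row (x - e1) (y - e2))
      + of_bool (col x (y + 1) \<and> \<not> col (x - e1) (y + 1 - e2)) = (2::int)"
    using height_right[of x y] height_up[of "x + 1" y] height_up[of x y] height_right[of x "y + 1"]
    by linarith+
  then have C: "col x y" "\<not> col (x - e1) (y - e2)" "col x (y + 1)"
    and R: "row x y" "\<not> row (x - e1) (y - e2)" "row (x + 1) y"
    by (auto simp: of_bool_def split: if_splits)
  then have "height (x + 1) y = height x y + 1" "height x (y + 1) = height x y + 1"
    by (simp_all add: height_right height_up)
  obtain t where "y + 1 \<le> t" "(x, t) \<in> S" using C by (auto simp: col_def)
  then obtain y' where y': "y + 1 \<le> y'" "(x, y') \<in> S" "\<And>r. y + 1 \<le> r \<Longrightarrow> r < y' \<Longrightarrow> (x, r) \<notin> S"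
    using least_int_above[of "\<lambda>t. (x, t) \<in> S"] by metis
  obtain t where "x + 1 \<le> t" "(t, y) \<in> S" using R by (auto simp: row_def)
  then obtain x' where x': "x + 1 \<le> x'" "(x', y) \<in> S" "\<And>r. x + 1 \<le> r \<Longrightarrow> r < x' \<Longrightarrow> (r, y) \<notin> S"
    using least_int_above[of "\<lambda>t. (t, y) \<in> S"] by metis
  \<comment> \<open>The translated column is empty from \<open>y - e2\<close> upwards, hence misses
    the translate of \<open>(x, y')\<close>.\<close>
  have "(x, y') \<in> Ap" using y' C colI[of "x - e1" "y' - e2" "y - e2"] by (auto simp: Ap_iff)
  moreover have "(x', y) \<in> Ap" using x' R rowI[of "x' - e1" "y - e2" "x - e1"] by (auto simp: Ap_iff)
  moreover have "height x y' = height x y + 1"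
    using height_above_least_in_column[of "y + 1" y' x] y' \<open>height x (y + 1) = _\<close> by auto
  moreover have "height x' y = height x y + 1"
    using height_right_of_least_in_row[of "x + 1" x' y] x' \<open>height (x + 1) y = _\<close> by auto
  ultimately show ?thesis using x'(1) y'(1) by (meson zless_add1_eq add1_zle_eq)
qed

section \<open>Levels as sets of constant height\<close>

lemma zero_Ap: "(0, 0) \<in> Ap"
  using zero e_pos nonneg[of "- e1" "- e2"] by (auto simp: Ap_iff)

lemma height_nonneg: "height x y \<ge> 0"
  using height_mono[of "min x 0" x "min y 0" y] height_nonpos[of "min x 0" "min y 0"] by simp

text \<open>Points strictly above the origin have positive height by
  \<open>height_strict_mono\<close>, and locality excludes other elements on the axes. This pins
  down the lowest level.\<close>

lemma height_eq_0_iff: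
  assumes "(x, y) \<in> S"
  shows "height x y = 0 \<longleftrightarrow> x = 0 \<and> y = 0"
proof
  assume "height x y = 0"
  then have "\<not> (0 < x \<and> 0 < y)"
    using height_strict_mono[OF zero_Ap, of x y] height_nonneg[of 0 0] by auto
  then show "x = 0 \<and> y = 0" using local[OF assms] nonneg[OF assms] by linarith
qed (simp add: height_nonpos)

text \<open>One round of the level construction strips off the top height. Elements of height
  \<open>k\<close> survive by \<open>height_strict_mono\<close> and \<open>height_infimum\<close>;
  by \<open>Ap_successor\<close> a lower element is either not maximal or a proper infimum of
  maximal ones.\<close>

lemma lele_maximal_minus_proper_infima:
  assumes k: "k < e1 + e2"
  defines "X \<equiv> {p \<in> Ap. height (fst p) (snd p) \<le> k}"
  shows "lele_maximal X - proper_infima (lele_maximal X) = {p \<in> Ap. height (fst p) (snd p) = k}"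
    (is "?L = ?R")
proof -
  have X: "(a, b) \<in> X \<longleftrightarrow> (a, b) \<in> Ap \<and> height a b \<le> k" for a b
    by (simp add: X_def)
  have max_iff: "(x, y) \<in> lele_maximal X \<longleftrightarrow> (x, y) \<in> X \<and> (\<forall>a b. x < a \<longrightarrow> y < b \<longrightarrow> (a, b) \<notin> X)" for x y
    unfolding lele_maximal_def lele_def strictly_below_def
    by (simp add: Ball_def) blast
  \<comment> \<open>As neither element equals the infimum, one lies in its row and the other in its
    column.\<close>
  have inf_iff: "(x, y) \<in> proper_infima B \<longleftrightarrow> (x, y) \<in> B \<and> (\<exists>a b. x < a \<and> y < b \<and> (a, y) \<in> B \<and> (x, b) \<in> B)"
    (is "?lhs = ?rhs") for x y B
  proof
    assume ?lhs
    then obtain p q where "(x, y) \<in> B" "p \<in> B" "q \<in> B" "p \<noteq> (x, y)" "q \<noteq> (x, y)" "(x, y) = inf p q"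
      unfolding proper_infima_def by blast
    moreover obtain a b c d where "p = (a, b)" "q = (c, d)" by (cases p, cases q)
    ultimately have B: "(x, y) \<in> B" "(a, b) \<in> B" "(c, d) \<in> B"
      and "a \<noteq> x \<or> b \<noteq> y" "c \<noteq> x \<or> d \<noteq> y" "x = min a c" "y = min b d"
      by (simp_all add: inf_prod_def inf_min)
    from this(4-) consider "x < a" "b = y" "c = x" "y < d" | "x < c" "d = y" "a = x" "y < b"
      by linarith
    then show ?rhs using B by cases blast+
  next
    assume ?rhs
    then obtain a b where *: "(x, y) \<in> B" "x < a" "y < b" "(a, y) \<in> B" "(x, b) \<in> B" by blast
    have "(x, y) = inf (a, y) (x, b)" using * by (simp add: inf_prod_def inf_min)
    moreover have "(a, y) \<in> B - {(x, y)}" "(x, b) \<in> B - {(x, y)}" using * by auto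
    ultimately show ?lhs using *(1) unfolding proper_infima_def by blast
  qed
  have "(x, y) \<in> ?L \<longleftrightarrow> (x, y) \<in> ?R" for x y
  proof
    assume "(x, y) \<in> ?R"
    then have xy: "(x, y) \<in> Ap" "height x y = k" by auto
    have "(x, y) \<in> lele_maximal X"
      unfolding max_iff X using xy height_strict_mono[OF xy(1)] by (meson not_le order_refl)
    moreover have "(x, y) \<notin> proper_infima (lele_maximal X)"
    proof
      assume "(x, y) \<in> proper_infima (lele_maximal X)"
      then obtain a b where "x < a" "y < b" "height a y \<le> k" "height x b \<le> k"
        unfolding inf_iff max_iff X by blast
      then show False using height_infimum[OF xy(1), of a b] xy(2) by simp
    qed
    ultimately show "(x, y) \<in> ?L" by blast
  next
    assume "(x, y) \<in> ?L"
    then have max: "(x, y) \<in> lele_maximal X" and notinf: "(x, y) \<notin> proper_infima (lele_maximal X)"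
      by auto
    have xy: "(x, y) \<in> Ap" "height x y \<le> k"
      and none: "\<And>a b. x < a \<Longrightarrow> y < b \<Longrightarrow> (a, b) \<notin> X"
      using max unfolding max_iff X by auto
    have "height x y = k"
    proof (rule ccontr)
      assume "height x y \<noteq> k"
      then have less: "height x y + 1 \<le> k" "height x y + 1 < e1 + e2" using xy k by auto
      from Ap_successor[OF xy(1) less(2)] show False
      proof (elim disjE exE conjE)
        fix x' y' assume "x < x'" "y < y'" "(x', y') \<in> Ap" "height x' y' = height x y + 1"
        then show False using none[of x' y'] less by (simp add: X)
      next
        fix x' y' assume *: "x < x'" "y < y'" "(x', y) \<in> Ap" "(x, y') \<in> Ap"
          "height x' y = height x y + 1" "height x y' = height x y + 1"
        have "(x', y) \<in> X" "(x, y') \<in> X" using * less by (simp_all add: X)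
        \<comment> \<open>Anything strictly above either neighbour would be strictly above
          \<open>(x, y)\<close>.\<close>
        then have "(x', y) \<in> lele_maximal X" "(x, y') \<in> lele_maximal X"
          using none *(1,2) unfolding max_iff by (meson less_trans)+
        then show False using notinf max *(1,2) unfolding inf_iff by blast
      qed
    qed
    then show "(x, y) \<in> ?R" using xy by simp
  qed
  then show ?thesis by (intro set_eqI) (simp only: split_paired_all)
qed

text \<open>Apery heights stay below \<open>e1 + e2\<close>, so by induction removing the earlier
  levels leaves exactly the heights up to \<open>e1 + e2 - i\<close>.\<close>

lemma level_D_eq:
  assumes Ap: "Apery S = Ap" and "1 \<le> i"
  shows "level_D S i = {p \<in> Ap. height (fst p) (snd p) = e1 + e2 - int i}"
  using assms(2)
proof (induction i rule: less_induct)
  case (less i)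
  have "p \<in> Apery S - (\<Union>j\<in>{1..<i}. level_D S j) \<longleftrightarrow>
      p \<in> Ap \<and> height (fst p) (snd p) \<le> e1 + e2 - int i" for p
  proof (cases "p \<in> Ap")
    case True
    let ?h = "height (fst p) (snd p)"
    have "?h < e1 + e2" using height_less[of "fst p" "snd p"] True by simp
    have "p \<in> (\<Union>j\<in>{1..<i}. level_D S j) \<longleftrightarrow> (\<exists>j\<in>{1..<i}. ?h = e1 + e2 - int j)"
      using True less.IH by simp
    also have "\<dots> \<longleftrightarrow> \<not> ?h \<le> e1 + e2 - int i"
    proof
      assume "\<not> ?h \<le> e1 + e2 - int i"
      then show "\<exists>j\<in>{1..<i}. ?h = e1 + e2 - int j"
        using \<open>?h < e1 + e2\<close> by (intro bexI[of _ "nat (e1 + e2 - ?h)"]) auto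
    qed auto
    finally show ?thesis using True Ap by simp
  qed (simp add: Ap)
  then have "Apery S - (\<Union>j\<in>{1..<i}. level_D S j) =
      {p \<in> Ap. height (fst p) (snd p) \<le> e1 + e2 - int i}"
    by (intro set_eqI) simp
  then show ?case
    using lele_maximal_minus_proper_infima[of "e1 + e2 - int i"] less.prems
    by (subst level_D.simps) (simp add: Let_def)
qed

text \<open>Fewer levels do not suffice: the origin has height 0 and so occurs only at index
  \<open>e1 + e2\<close>.\<close>

lemma num_levels_eq:
  assumes Ap: "Apery S = Ap"
  shows "num_levels S = nat (e1 + e2)"
  unfolding num_levels_def
proof (rule Least_equality)
  show "Apery S = (\<Union>i\<in>{1..nat (e1 + e2)}. level_D S i)"
  proof (intro equalityI subsetI)
    fix p assume "p \<in> Apery S"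
    obtain x y where p: "p = (x, y)" by force
    have "(x, y) \<in> Ap" using \<open>p \<in> Apery S\<close> p Ap by simp
    then show "p \<in> (\<Union>i\<in>{1..nat (e1 + e2)}. level_D S i)"
      using p height_less[of x y] height_nonneg[of x y]
      by (intro UN_I[of "nat (e1 + e2 - height x y)"]) (auto simp: level_D_eq[OF Ap])
  qed (auto simp: level_D_eq[OF Ap] Ap)
next
  fix N assume N: "Apery S = (\<Union>i\<in>{1..N}. level_D S i)"
  obtain i where "i \<in> {1..N}" "(0, 0) \<in> level_D S i" using zero_Ap N Ap by blast
  then show "nat (e1 + e2) \<le> N" using height_nonpos[of 0 0] by (auto simp: level_D_eq[OF Ap])
qed

lemma level_A_eq:
  assumes Ap: "Apery S = Ap" and "1 \<le> i" "int i \<le> e1 + e2"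
  shows "level_A S i = {p \<in> Ap. height (fst p) (snd p) = int i - 1}"
  using assms(2,3) by (auto simp: level_A_def num_levels_eq[OF Ap] level_D_eq[OF Ap])

end

section \<open>Duality of rays, counts and heights under symmetry\<close>

locale symmetric_pair = good_pair +
  assumes symmetric_nonneg: "0 \<le> x \<Longrightarrow> 0 \<le> y \<Longrightarrow>
    (x, y) \<in> S \<longleftrightarrow> \<not> col (c1 - 1 - x) (c2 - y) \<and> \<not> row (c1 - x) (c2 - 1 - y)"
begin

text \<open>Outside the quadrant both sides fail, since a dual ray then lies beyond
  \<open>c1\<close> or \<open>c2\<close> and meets \<open>S\<close>.\<close>

lemma symmetric: "(x, y) \<in> S \<longleftrightarrow> \<not> col (c1 - 1 - x) (c2 - y) \<and> \<not> row (c1 - x) (c2 - 1 - y)"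
  using symmetric_nonneg[of x y] nonneg[of x y] col_large[of "c1 - 1 - x"] row_large[of "c2 - 1 - y"]
  by (cases "0 \<le> x"; cases "0 \<le> y") auto

text \<open>If both rays met \<open>S\<close>, a sum of elements would meet the column
  \<open>c1 - 1\<close> at or above \<open>c2\<close>, against \<open>0 \<in> S\<close>. If neither
  did, symmetry and (G2) would extend the empty dual ray downwards without end, forcing an element
  in a row of negative index.\<close>

lemma col_dual: "col (c1 - 1 - x) (c2 - y) \<longleftrightarrow> \<not> col x y"
proof
  assume "col (c1 - 1 - x) (c2 - y)"
  then obtain t where t: "c2 - y \<le> t" "(c1 - 1 - x, t) \<in> S" by (rule colE)
  show "\<not> col x y"
  proof
    assume "col x y"
    then obtain s where "y \<le> s" "(x, s) \<in> S" by (rule colE)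
    then have "col (c1 - 1) c2" using add[of x s "c1 - 1 - x" t] t by (intro colI[of _ "s + t"]) auto
    then show False using symmetric[of 0 0] zero by simp
  qed
next
  assume nocol: "\<not> col x y"
  show "col (c1 - 1 - x) (c2 - y)"
  proof (rule ccontr)
    assume none: "\<not> col (c1 - 1 - x) (c2 - y)"
    \<comment> \<open>The point \<open>(x, y + k)\<close> is not in \<open>S\<close>, so by symmetry
      one of its dual rays meets \<open>S\<close>; the column ray is excluded.\<close>
    have row_if: "row (c1 - x) (c2 - 1 - (y + k))"
      if "0 \<le> k" "\<not> col (c1 - 1 - x) (c2 - (y + k))" for k
      using that symmetric[of x "y + k"] nocol colI[of x "y + k" y] by auto
    have down: "\<not> col (c1 - 1 - x) (c2 - (y + k))" if "0 \<le> k" for k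
      using that
    proof (induction k rule: int_ge_induct)
      case base
      then show ?case using none by simp
    next
      case (step k)
      obtain t where t: "c1 - x \<le> t" "(t, c2 - 1 - (y + k)) \<in> S"
        using row_if[OF step] by (rule rowE)
      \<comment> \<open>Otherwise (G2), applied with the element further right in this row, puts an
        element into the empty ray above.\<close>
      have "(c1 - 1 - x, c2 - 1 - (y + k)) \<notin> S"
      proof
        assume "(c1 - 1 - x, c2 - 1 - (y + k)) \<in> S"
        then obtain y' where "y' > c2 - 1 - (y + k)" "(c1 - 1 - x, y') \<in> S"
          using exchange_up[of "c1 - 1 - x" "c2 - 1 - (y + k)" t] t by auto
        then show False using step.IH colI[of "c1 - 1 - x" y' "c2 - (y + k)"] by auto
      qed
      then show ?case using step.IH col_Suc[of "c1 - 1 - x" "c2 - 1 - (y + k)"]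
        by (simp add: algebra_simps)
    qed
    define k where "k = max 0 (c2 - y)"
    have "0 \<le> k" "c2 - 1 - (y + k) < 0" by (auto simp: k_def)
    then show False using row_if[OF _ down] row_neg by blast
  qed
qed

text \<open>The mirror image of \<open>col_dual\<close>: here emptiness spreads to the left.\<close>

lemma row_dual: "row (c1 - x) (c2 - 1 - y) \<longleftrightarrow> \<not> row x y"
proof
  assume "row (c1 - x) (c2 - 1 - y)"
  then obtain t where t: "c1 - x \<le> t" "(t, c2 - 1 - y) \<in> S" by (rule rowE)
  show "\<not> row x y"
  proof
    assume "row x y"
    then obtain s where "x \<le> s" "(s, y) \<in> S" by (rule rowE)
    then have "row c1 (c2 - 1)" using add[of s y t "c2 - 1 - y"] t by (intro rowI[of "s + t"]) auto
    then show False using symmetric[of 0 0] zero by simp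
  qed
next
  assume norow: "\<not> row x y"
  show "row (c1 - x) (c2 - 1 - y)"
  proof (rule ccontr)
    assume none: "\<not> row (c1 - x) (c2 - 1 - y)"
    have col_if: "col (c1 - 1 - (x + k)) (c2 - y)"
      if "0 \<le> k" "\<not> row (c1 - (x + k)) (c2 - 1 - y)" for k
      using that symmetric[of "x + k" y] norow rowI[of "x + k" y x] by auto
    have left: "\<not> row (c1 - (x + k)) (c2 - 1 - y)" if "0 \<le> k" for k
      using that
    proof (induction k rule: int_ge_induct)
      case base
      then show ?case using none by simp
    next
      case (step k)
      obtain t where t: "c2 - y \<le> t" "(c1 - 1 - (x + k), t) \<in> S"
        using col_if[OF step] by (rule colE)
      have "(c1 - 1 - (x + k), c2 - 1 - y) \<notin> S"
      proof
        assume "(c1 - 1 - (x + k), c2 - 1 - y) \<in> S"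
        then obtain x' where "x' > c1 - 1 - (x + k)" "(x', c2 - 1 - y) \<in> S"
          using exchange_right[of "c1 - 1 - (x + k)" "c2 - 1 - y" t] t by auto
        then show False using step.IH rowI[of x' "c2 - 1 - y" "c1 - (x + k)"] by auto
      qed
      then show ?case using step.IH row_Suc[of "c1 - 1 - (x + k)" "c2 - 1 - y"]
        by (simp add: algebra_simps)
    qed
    define k where "k = max 0 (c1 - x)"
    have "0 \<le> k" "c1 - 1 - (x + k) < 0" by (auto simp: k_def)
    then show False using col_if[OF _ left] col_neg by blast
  qed
qed

text \<open>Exactly one of a unit step and its dual step is counted, so the defect \<open>g\<close>
  is constant; its value is read off at the origin.\<close>

lemma len_dual: "len (c1 - x) (c2 - y) = len x y - x - y + len c1 c2"
proof -
  define g where "g x y = len (c1 - x) (c2 - y) - len x y + x + y" for x y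
  have right: "g (x + 1) y = g x y" for x y
    using len_right[of x y] len_right[of "c1 - 1 - x" "c2 - y"] col_dual[of x y]
    by (auto simp: g_def algebra_simps)
  have up: "g x (y + 1) = g x y" for x y
    using len_up[of x y] len_up[of "c1 - x" "c2 - 1 - y"] row_dual[of x y]
    by (auto simp: g_def algebra_simps)
  have "g x y = g 0 y"
  proof (induction x rule: int_induct[where k = 0])
    case (step2 i)
    then show ?case using right[of "i - 1" y] by simp
  qed (simp_all add: right)
  also have "g 0 y = g 0 0"
  proof (induction y rule: int_induct[where k = 0])
    case (step2 i)
    then show ?case using up[of 0 "i - 1"] by simp
  qed (simp_all add: up)
  finally show ?thesis by (simp add: g_def len_def)
qed

lemma height_dual: "height (c1 + e1 - x) (c2 + e2 - y) = e1 + e2 - height x y"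
  using len_dual[of x y] len_dual[of "x - e1" "y - e2"]
  by (simp add: height_def algebra_simps)

text \<open>
  The coordinate \<open>2 * c2 + e2\<close> only has to be large: then the complement of \<open>(a, b)\<close> lies so high
  in its column that its membership is decided by whether the dual column \<open>a - e1\<close> is empty.
\<close>

lemma Ap_complement:
  assumes i: "1 \<le> i" "i \<le> e1"
  shows "\<exists>a b. (a, b) \<in> Ap \<and> height a b = i - 1 \<and>
    (c1 - 1 + e1 - a, 2 * c2 + e2 - b) \<in> Ap \<and>
    height (c1 - 1 + e1 - a) (2 * c2 + e2 - b) = e1 + e2 - i"
proof -
  \<comment> \<open>Since the axis reaches height \<open>e1\<close>, it has an \<open>i\<close>-th
    jump; \<open>s\<close> is the abscissa just after it, hence \<open>a = s - 1\<close>.\<close>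
  have "height (c1 + e1) 0 \<ge> i" "0 \<le> c1 + e1" using height_large_x i e_pos c_nonneg by auto
  then obtain s where s: "0 \<le> s" "height s 0 \<ge> i" "\<And>r. 0 \<le> r \<Longrightarrow> r < s \<Longrightarrow> \<not> height r 0 \<ge> i"
    using least_int_above[of "\<lambda>s. height s 0 \<ge> i" "c1 + e1" 0] by metis
  have "s \<noteq> 0" using s i height_nonpos[of 0 0] by auto
  define a where "a = s - 1"
  have "0 \<le> a" "height a 0 < i" "i \<le> height (a + 1) 0"
    using s \<open>s \<noteq> 0\<close> by (auto simp: a_def not_le[symmetric])
  then have a: "height a 0 = i - 1" "height (a + 1) 0 = i" "col a 0" "\<not> col (a - e1) (- e2)"
    using height_right[of a 0] by (simp_all add: of_bool_def split: if_splits)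
  obtain t where "0 \<le> t" "(a, t) \<in> S" using a(3) by (rule colE)
  then obtain b where b: "0 \<le> b" "(a, b) \<in> S" "\<And>r. 0 \<le> r \<Longrightarrow> r < b \<Longrightarrow> (a, r) \<notin> S"
    using least_int_above[of "\<lambda>t. (a, t) \<in> S"] by metis
  have "height a b = i - 1" using height_above_least_in_column[of 0 b a] b a by auto
  have empty: "\<not> col (a - e1) y" for y
    using a(4) col_nonpos[of "- e2" "a - e1"] e_pos nonneg by (force elim!: colE intro: colI)
  have "(a, b) \<in> Ap" using b(2) empty[of "b - e2"] by (auto simp: Ap_iff intro: colI)
  have "b \<le> c2"
  proof (rule ccontr)
    assume "\<not> b \<le> c2"
    \<comment> \<open>The minimum with a point of row \<open>c2\<close> beyond \<open>c1\<close>
      would be a lower element of the column.\<close>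
    then have "(a, c2) \<in> S" using minimum[OF b(2) above_c[of "max a c1" c2]] by (simp add: min_def split: if_splits)
    then show False using b(3)[of c2] \<open>\<not> b \<le> c2\<close> c_nonneg by auto
  qed
  have "(c1 - 1 + e1 - a, 2 * c2 + e2 - b) \<in> S"
    using empty[of "b - c2 - e2"] row_neg[of "b - c2 - e2 - 1" "a + 1 - e1"] \<open>b \<le> c2\<close> e_pos
    by (subst symmetric) (simp add: algebra_simps)
  \<comment> \<open>Its dual column is that of \<open>a\<close>, started at
    \<open>b - c2 \<le> b\<close>, so it contains \<open>(a, b)\<close>.\<close>
  moreover have "(c1 - 1 - a, 2 * c2 - b) \<notin> S"
    using colI[OF b(2), of "b - c2"] c_nonneg by (subst symmetric) simp
  ultimately have "(c1 - 1 + e1 - a, 2 * c2 + e2 - b) \<in> Ap" by (simp add: Ap_iff algebra_simps)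
  \<comment> \<open>The dual point has abscissa \<open>a + 1\<close>, just past the jump, and
    nonpositive ordinate, so its height is \<open>i\<close> rather than
    \<open>i - 1\<close>.\<close>
  moreover have "height (c1 - 1 + e1 - a) (2 * c2 + e2 - b) = e1 + e2 - i"
    using height_dual[of "a + 1" "b - c2"] height_nonpos_y[of "b - c2" "a + 1"] a(2) \<open>b \<le> c2\<close>
    by (simp add: algebra_simps)
  ultimately show ?thesis using \<open>(a, b) \<in> Ap\<close> \<open>height a b = i - 1\<close> by blast
qed

end

section \<open>From the order-theoretic definitions to coordinates\<close>

lemma good_semigroup_nonneg: "good_semigroup S \<Longrightarrow> S \<subseteq> {0..}"
  by (simp add: good_semigroup_def)

lemma good_semigroup_inf: "good_semigroup S \<Longrightarrow> \<alpha> \<in> S \<Longrightarrow> \<beta> \<in> S \<Longrightarrow> inf \<alpha> \<beta> \<in> S"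
  by (simp add: good_semigroup_def)

lemma good_semigroup_conductor: "good_semigroup S \<Longrightarrow> \<exists>c\<in>S. \<forall>\<nu>\<ge>0. c + \<nu> \<in> S"
  unfolding good_semigroup_def by (elim conjE)

lemma good_semigroup_exchange_right:
  assumes "good_semigroup S" "(x, y) \<in> S" "(x, y') \<in> S" "y < y'"
  shows "\<exists>x'>x. (x', y) \<in> S"
proof -
  have "\<forall>\<alpha>\<in>S. \<forall>\<beta>\<in>S. fst \<alpha> = fst \<beta> \<longrightarrow>
        (\<exists>\<delta>\<in>S. fst \<delta> > fst \<alpha> \<and> snd \<delta> \<ge> min (snd \<alpha>) (snd \<beta>) \<and>
           (snd \<alpha> \<noteq> snd \<beta> \<longrightarrow> snd \<delta> = min (snd \<alpha>) (snd \<beta>)))"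
    using assms(1) unfolding good_semigroup_def by (elim conjE)
  from this[rule_format, OF assms(2,3)] obtain \<delta> where "\<delta> \<in> S" "fst \<delta> > x" "snd \<delta> = y"
    using assms(4) by auto
  then show ?thesis by (metis prod.collapse)
qed

lemma good_semigroup_exchange_up:
  assumes "good_semigroup S" "(x, y) \<in> S" "(x', y) \<in> S" "x < x'"
  shows "\<exists>y'>y. (x, y') \<in> S"
proof -
  have "\<forall>\<alpha>\<in>S. \<forall>\<beta>\<in>S. snd \<alpha> = snd \<beta> \<longrightarrow>
        (\<exists>\<delta>\<in>S. snd \<delta> > snd \<alpha> \<and> fst \<delta> \<ge> min (fst \<alpha>) (fst \<beta>) \<and>
           (fst \<alpha> \<noteq> fst \<beta> \<longrightarrow> fst \<delta> = min (fst \<alpha>) (fst \<beta>)))"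
    using assms(1) unfolding good_semigroup_def by (elim conjE)
  from this[rule_format, OF assms(2,3)] obtain \<delta> where "\<delta> \<in> S" "snd \<delta> > y" "fst \<delta> = x"
    using assms(4) by auto
  then show ?thesis by (metis prod.collapse)
qed

text \<open>The least element exists because the candidates are closed under infima: by
  distributivity a point above \<open>inf \<alpha> \<beta>\<close> is the infimum of its suprema
  with \<open>\<alpha>\<close> and \<open>\<beta>\<close>.\<close>

lemma conductor_mem:
  assumes "good_semigroup S" "0 \<le> \<nu>"
  shows "conductor S + \<nu> \<in> S"
proof -
  define C where "C = {\<alpha>. \<forall>\<nu>\<ge>0. \<alpha> + \<nu> \<in> S}"
  have C: "\<alpha> \<in> C \<longleftrightarrow> (\<forall>p\<ge>\<alpha>. p \<in> S)" for \<alpha>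
  proof
    assume "\<alpha> \<in> C"
    moreover have "0 \<le> p - \<alpha>" if "\<alpha> \<le> p" for p
      using that by (simp add: less_eq_prod_def)
    ultimately have "\<alpha> + (p - \<alpha>) \<in> S" if "\<alpha> \<le> p" for p
      using that unfolding C_def by blast
    then show "\<forall>p\<ge>\<alpha>. p \<in> S" by simp
  next
    assume "\<forall>p\<ge>\<alpha>. p \<in> S"
    moreover have "\<alpha> \<le> \<alpha> + \<nu>" if "0 \<le> \<nu>" for \<nu>
      using that by (simp add: less_eq_prod_def)
    ultimately show "\<alpha> \<in> C" unfolding C_def by blast
  qed
  have "C \<noteq> {}" using good_semigroup_conductor[OF assms(1)] unfolding C_def by blast
  moreover have "C \<subseteq> S" using C by (meson order_refl subsetI)
  then have "C \<subseteq> {0..}" using good_semigroup_nonneg[OF assms(1)] by (rule subset_trans)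
  moreover have "inf \<alpha> \<beta> \<in> C" if "\<alpha> \<in> C" "\<beta> \<in> C" for \<alpha> \<beta>
    unfolding C
  proof (intro allI impI)
    fix p assume "inf \<alpha> \<beta> \<le> p"
    have "sup p \<alpha> \<in> S" "sup p \<beta> \<in> S" using that sup_ge2 unfolding C by blast+
    then have "inf (sup p \<alpha>) (sup p \<beta>) \<in> S" by (rule good_semigroup_inf[OF assms(1)])
    moreover have "inf (sup p \<alpha>) (sup p \<beta>) = p"
      unfolding sup_inf_distrib1[symmetric] using \<open>inf \<alpha> \<beta> \<le> p\<close> by (rule sup.absorb1)
    ultimately show "p \<in> S" by simp
  qed
  ultimately have "(LEAST p. p \<in> C) \<in> C" by (rule Least_of_inf_closed)
  then show ?thesis using assms(2) unfolding C_def conductor_def mem_Collect_eq by blast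
qed

text \<open>Locality makes the first coordinate of every nonzero element nonzero, so infima of
  nonzero elements stay nonzero.\<close>

lemma min_nonzero_mem:
  assumes "local_good_semigroup S"
  shows "min_nonzero S \<in> S - {0}"
  unfolding min_nonzero_def
proof (rule Least_of_inf_closed)
  have good: "good_semigroup S" using assms by (simp add: local_good_semigroup_def)
  have nonneg: "S \<subseteq> {0..}" using good by (rule good_semigroup_nonneg)
  then show "S - {0} \<subseteq> {0..}" by blast
  have "conductor S \<in> S" using conductor_mem[OF good, of 0] by simp
  then have "conductor S \<in> {0..}" using nonneg by (rule subsetD[rotated])
  then have "fst (conductor S + (1, 1)) \<noteq> fst 0" by (simp add: less_eq_prod_def)
  then have "conductor S + (1, 1) \<noteq> 0" by (rule contrapos_nn) simp
  moreover have "conductor S + (1, 1) \<in> S" by (rule conductor_mem[OF good]) (simp add: less_eq_prod_def)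
  ultimately show "S - {0} \<noteq> {}" by blast
  fix p q assume pq: "p \<in> S - {0}" "q \<in> S - {0}"
  then have "inf p q \<in> S" using good_semigroup_inf[OF good] by blast
  moreover have "fst p \<noteq> 0" "fst q \<noteq> 0"
    using pq assms unfolding local_good_semigroup_def by blast+
  then have "fst (inf p q) \<noteq> fst 0" by (simp add: inf_int_def min_def)
  then have "inf p q \<noteq> 0" by (rule contrapos_nn) simp
  ultimately show "inf p q \<in> S - {0}" by simp
qed

lemma good_pair_of_local_good_semigroup:
  assumes S: "local_good_semigroup S" and e: "min_nonzero S = (e1, e2)" and c: "conductor S = (c1, c2)"
  shows "good_pair S e1 e2 c1 c2"
proof -
  have good: "good_semigroup S" and local: "\<And>\<alpha>. \<alpha> \<in> S \<Longrightarrow> fst \<alpha> = 0 \<or> snd \<alpha> = 0 \<Longrightarrow> \<alpha> = 0"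
    using S unfolding local_good_semigroup_def by blast+
  have nonneg: "S \<subseteq> {0..}" using good by (rule good_semigroup_nonneg)
  have zero: "0 \<in> S" using good by (simp add: good_semigroup_def)
  have add: "\<alpha> + \<beta> \<in> S" if "\<alpha> \<in> S" "\<beta> \<in> S" for \<alpha> \<beta>
    using good that by (simp add: good_semigroup_def)
  have e_mem: "(e1, e2) \<in> S" "(e1, e2) \<noteq> 0" using min_nonzero_mem[OF S] e by auto
  have nonneg': "0 \<le> x \<and> 0 \<le> y" if "(x, y) \<in> S" for x y
    using nonneg that by (auto simp: less_eq_prod_def)
  show ?thesis
  proof
    fix x y x' y' :: int
    show "0 \<le> x \<and> 0 \<le> y" if "(x, y) \<in> S" using nonneg'[OF that] .
    show "(0, 0) \<in> S" using zero by (simp add: zero_prod_def)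
    show "(x + x', y + y') \<in> S" if "(x, y) \<in> S" "(x', y') \<in> S" using add[OF that] by simp
    show "(min x x', min y y') \<in> S" if "(x, y) \<in> S" "(x', y') \<in> S"
      using good_semigroup_inf[OF good that] by (simp add: inf_prod_def inf_min)
    show "\<exists>x'>x. (x', y) \<in> S" if "(x, y) \<in> S" "(x, y') \<in> S" "y < y'"
      using good_semigroup_exchange_right[OF good that] .
    show "\<exists>y'>y. (x, y') \<in> S" if "(x, y) \<in> S" "(x', y) \<in> S" "x < x'"
      using good_semigroup_exchange_up[OF good that] .
    show "x = 0 \<and> y = 0" if "(x, y) \<in> S" "x = 0 \<or> y = 0"
      using local[OF that(1)] that(2) by (simp add: zero_prod_def)
    show "(x, y) \<in> S" if "c1 \<le> x" "c2 \<le> y"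
      using conductor_mem[OF good, of "(x - c1, y - c2)"] that c by (simp add: less_eq_prod_def)
    show "(e1, e2) \<in> S" by (rule e_mem)
    have "e1 \<noteq> 0" "e2 \<noteq> 0" using local[OF e_mem(1)] e_mem(2) by auto
    then show "0 < e1" "0 < e2" using nonneg'[OF e_mem(1)] by auto
  qed
qed

lemma symmetric_pair_of_symmetric_semigroup:
  assumes "good_pair S e1 e2 c1 c2" "conductor S = (c1, c2)" "symmetric_semigroup S"
  shows "symmetric_pair S e1 e2 c1 c2"
proof -
  interpret good_pair S e1 e2 c1 c2 by fact
  show ?thesis
  proof
    fix x y :: int assume "0 \<le> x" "0 \<le> y"
    then have "(x, y) \<in> S \<longleftrightarrow> Delta S (c1 - 1 - x, c2 - 1 - y) = {}"
      using assms(2,3) by (simp add: symmetric_semigroup_def gamma_def less_eq_prod_def)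
    also have "\<dots> \<longleftrightarrow> \<not> col (c1 - 1 - x) (c2 - y) \<and> \<not> row (c1 - x) (c2 - 1 - y)"
    proof -
      \<comment> \<open>Over the integers the strict rays of \<open>Delta\<close> are the closed
        rays started one unit further.\<close>
      have "c2 - y \<le> t \<longleftrightarrow> c2 - 1 - y < t" "c1 - x \<le> t \<longleftrightarrow> c1 - 1 - x < t" for t by auto
      then show ?thesis unfolding Delta_def col_def row_def by force
    qed
    finally show "(x, y) \<in> S \<longleftrightarrow> \<not> col (c1 - 1 - x) (c2 - y) \<and> \<not> row (c1 - x) (c2 - 1 - y)" .
  qed
qed

section \<open>Construction of the sequences from complementary pairs\<close>

theorem theorem5p5:
  fixes S :: "(int \<times> int) set" and e\<^sub>1 e\<^sub>2 :: int and e :: nat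
  assumes "local_good_semigroup S"
    and "symmetric_semigroup S"
    and "min_nonzero S = (e\<^sub>1, e\<^sub>2)"
    and "int e = e\<^sub>1 + e\<^sub>2"
    and "e\<^sub>1 \<ge> e\<^sub>2"
  shows
    "(even e \<longrightarrow>
       (\<exists>\<alpha> :: nat \<Rightarrow> int \<times> int.
          \<forall>i\<in>{1..e}. \<alpha> i \<in> level_A S i \<and> \<alpha> i + \<alpha> (e - i + 1) = \<alpha> e)) \<and>
     (\<forall>d. odd e \<and> e + 1 = 2 * d \<longrightarrow>
       (\<exists>(\<alpha> :: nat \<Rightarrow> int \<times> int) \<beta>.
          (\<forall>i\<in>{1..e}. \<alpha> i \<in> level_A S i) \<and> \<beta> \<in> level_A S d \<and>
          (\<forall>i\<in>{1..e} - {d}. \<alpha> i + \<alpha> (e - i + 1) = \<alpha> e) \<and>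
          \<alpha> d + \<beta> = \<alpha> e))"
proof -
  obtain c1 c2 where c: "conductor S = (c1, c2)" by force
  interpret symmetric_pair S e\<^sub>1 e\<^sub>2 c1 c2
    by (intro symmetric_pair_of_symmetric_semigroup good_pair_of_local_good_semigroup assms c)
  have Ap: "Apery S = Ap" using assms(3) by (simp add: Apery_def Ap_def)
  have A: "level_A S i = {p \<in> Ap. height (fst p) (snd p) = int i - 1}" if "1 \<le> i" "i \<le> e" for i
    using that assms(4) by (intro level_A_eq[OF Ap]) auto
  define \<omega> where "\<omega> = (c1 - 1 + e\<^sub>1, 2 * c2 + e\<^sub>2)"
  have "\<exists>p. p \<in> level_A S i \<and> \<omega> - p \<in> level_A S (e + 1 - i)" if i: "1 \<le> i" "2 * i \<le> e + 1" for i
  proof -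
    \<comment> \<open>Here \<open>e\<^sub>1 \<ge> e\<^sub>2\<close> enters: \<open>2 * i \<le>
      e\<^sub>1 + e\<^sub>2 + 1 \<le> 2 * e\<^sub>1 + 1\<close>.\<close>
    have "int i \<le> e\<^sub>1" "i \<le> e" using i assms(4,5) by linarith+
    then obtain a b where "(a, b) \<in> Ap" "height a b = int i - 1"
      "(c1 - 1 + e\<^sub>1 - a, 2 * c2 + e\<^sub>2 - b) \<in> Ap"
      "height (c1 - 1 + e\<^sub>1 - a) (2 * c2 + e\<^sub>2 - b) = e\<^sub>1 + e\<^sub>2 - int i"
      using Ap_complement[of "int i"] i by auto
    then show ?thesis using i \<open>i \<le> e\<close> assms(4)
      by (intro exI[of _ "(a, b)"]) (auto simp: A \<omega>_def)
  qed
  then obtain p where p: "p i \<in> level_A S i" "\<omega> - p i \<in> level_A S (e + 1 - i)"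
    if "1 \<le> i" "2 * i \<le> e + 1" for i
    by metis
  have "2 \<le> e" using assms(4) e_pos by linarith
  \<comment> \<open>The lowest level contains only the origin, which makes the last term of the
    sequence equal to \<open>\<omega>\<close>.\<close>
  have "p 1 = 0"
  proof -
    have "p 1 \<in> Ap" "height (fst (p 1)) (snd (p 1)) = 0" using p(1)[of 1] A[of 1] \<open>2 \<le> e\<close> by auto
    then show ?thesis
      using height_eq_0_iff[of "fst (p 1)" "snd (p 1)"] by (simp add: Ap_def prod_eq_iff)
  qed
  \<comment> \<open>The lower half consists of chosen elements, the upper half of their complements.
    A middle index takes \<open>p\<close>, and its complement is kept for
    \<open>\<beta>\<close>.\<close>
  define \<alpha> where "\<alpha> i = (if 2 * i \<le> e + 1 then p i else \<omega> - p (e + 1 - i))" for i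
  have "\<alpha> e = \<omega>" using \<open>2 \<le> e\<close> \<open>p 1 = 0\<close> by (simp add: \<alpha>_def)
  have mem: "\<alpha> i \<in> level_A S i" if "i \<in> {1..e}" for i
    using that p(1)[of i] p(2)[of "e + 1 - i"] by (auto simp: \<alpha>_def)
  have sum: "\<alpha> i + \<alpha> (e - i + 1) = \<alpha> e" if "i \<in> {1..e}" "2 * i \<noteq> e + 1" for i
  proof -
    have "2 * (e - i + 1) \<le> e + 1 \<longleftrightarrow> \<not> 2 * i \<le> e + 1" "e + 1 - (e - i + 1) = i" "e + 1 - i = e - i + 1"
      using that by auto
    then show ?thesis unfolding \<open>\<alpha> e = \<omega>\<close> by (simp add: \<alpha>_def)
  qed
  show ?thesis
  proof (intro conjI impI allI)
    assume "even e"
    then have "2 * i \<noteq> e + 1" for i by presburger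
    then show "\<exists>\<alpha>. \<forall>i\<in>{1..e}. \<alpha> i \<in> level_A S i \<and> \<alpha> i + \<alpha> (e - i + 1) = \<alpha> e"
      using mem sum by blast
  next
    fix d assume d: "odd e \<and> e + 1 = 2 * d"
    have "\<omega> - p d \<in> level_A S d" "\<alpha> d + (\<omega> - p d) = \<alpha> e"
      using p(2)[of d] d \<open>\<alpha> e = \<omega>\<close> by (auto simp: \<alpha>_def)
    moreover have "\<forall>i\<in>{1..e} - {d}. \<alpha> i + \<alpha> (e - i + 1) = \<alpha> e"
      using sum d by auto
    ultimately show "\<exists>\<alpha> \<beta>. (\<forall>i\<in>{1..e}. \<alpha> i \<in> level_A S i) \<and> \<beta> \<in> level_A S d \<and>
        (\<forall>i\<in>{1..e} - {d}. \<alpha> i + \<alpha> (e - i + 1) = \<alpha> e) \<and> \<alpha> d + \<beta> = \<alpha> e"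
      using mem by blast
  qed
qed

end
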